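(* Let $S$ be an oriented $C^1$ surface in $\mathbb{R}^3$ whose normal line congruence is parameterized by $\xi=\xi_0(\mu,\bar\mu)$, $\eta=\eta_0(\mu,\bar\mu)$, $r=r_0(\mu,\bar\mu)$. Hamilton's point characteristic function for reflection in $S$ is \[ V((z_1,t_1),(z_2,t_2))=\pm\left|s_1-s_2+\frac{2|\xi_1-\xi_2|}{\left[(1+\xi_1\bar{\xi}_1)(1+\xi_2\bar{\xi}_2)\right]^{\frac12}}\,r_0\right|, \] where \[ s_i=\frac{\bar{\xi}_iz_i+\xi_i\bar{z}_i+(1-\xi_i\bar{\xi}_i)t_i}{1+\xi_i\bar{\xi}_i}\quad(i=1,2),\qquad \xi_2=\frac{2\xi_0\bar{\xi}_1+1-\xi_0\bar{\xi}_0}{(1-\xi_0\bar{\xi}_0)\bar{\xi}_1-2\bar{\xi}_0}, \] and $\xi_0=\xi_0(\mu,\bar\mu)$ (with corresponding $\eta_0=\eta_0(\mu,\bar\mu)$, $r_0=r_0(\mu,\bar\mu)$) and $\xi_1$ solve the two equations \begin{align*} z_2[(1-\xi_0\bar{\xi}_0)\bar{\xi}_1-2\bar{\xi}_0]^2&-2t_2[(1-\xi_0\bar{\xi}_0)\bar{\xi}_1-2\bar{\xi}_0][2\xi_0\bar{\xi}_1+1-\xi_0\bar{\xi}_0]-\bar{z}_2[2\xi_0\bar{\xi}_1+1-\xi_0\bar{\xi}_0]^2\\ &=-(1+\xi_0\bar{\xi}_0)^2(\bar{z}_1-2t_1\bar{\xi}_1-z_1\bar{\xi}_1^2)+4(\bar{\xi}_0-\bar{\xi}_1)(1+\xi_0\bar{\xi}_1)(1+\xi_0\bar{\xi}_0)r_0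 \end{align*} and \begin{align*} (1+\xi_0\bar{\xi}_0)^2\left(z_1-2t_1\xi_1-\bar{z}_1\xi_1^2\right)&=2(1+\bar{\xi}_0\xi_1)^2\eta_0-2(\xi_0-\xi_1)^2\bar{\eta}_0\\ &\quad+2(1+\bar{\xi}_0\xi_1)(\xi_0-\xi_1)(1+\xi_0\bar{\xi}_0)r_0, \end{align*} and $\xi_0\in\pi_1\circ\Phi_S^{-1}(S)$.
   Context: Oriented lines: $\mathbb{L}$ is the set of oriented affine lines in Euclidean $\mathbb{R}^3$, identified with the tangent bundle of the unit sphere $S^2=\mathbb{P}^1$. A direction (unit vector $v$) is described by the complex coordinate $\xi=\tan(\theta/2)e^{i\phi}$ (stereographic projection from the south pole), so $v_1+iv_2=\frac{2\xi}{1+\xi\bar\xi}$, $v_3=\frac{1-\xi\bar\xi}{1+\xi\bar\xi}$; throughout one works in the patch omitting the south direction. An oriented line has coordinates $(\xi,\eta)\in\mathbb{C}^2$, where $\xi$ is its direction and the tangent vector $\eta\,\partial_\xi+\bar\eta\,\partial_{\bar\xi}$ represents the perpendicular vector from the origin to the line. Write points of $\mathbb{R}^3$ as $(z,t)$ with $z=x^1+ix^2$, $t=x^3$. The map $\Phi:\mathbb{L}\times\mathbb{R}\to\mathbb{R}^3$ sends $((\xi,\eta),r)$ to the point on the line $(\xi,\eta)$ at signed affine parameter distance $r$ from the point of the line closest to the origin: \[ z=\frac{2(\eta-\bar\eta\xi^2)+2\xi(1+\xi\bar\xi)r}{(1+\xi\bar\xi)^2},\qquad t=\frac{-2(\eta\bar\xi+\bar\eta\xi)+(1-\xi^2\bar\xi^2)r}{(1+\xi\bar\xi)^2}.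 \] The map $\pi_1:\mathbb{L}\times\mathbb{R}\to\mathbb{P}^1$ is $((\xi,\eta),r)\mapsto\xi$. Surfaces: for an oriented $C^1$ surface $S\subset\mathbb{R}^3$, $\Phi_S^{-1}:S\to\mathbb{L}\times\mathbb{R}$ sends $p\in S$ to the oriented normal line $(\xi_0,\eta_0)$ to $S$ at $p$ together with the (signed) distance $r_0$ of $p$ from the point on that normal line closest to the origin. Thus $\pi_1\circ\Phi_S^{-1}$ is the Gauss map of $S$. The normal congruence of $S$ is parameterized locally by a complex parameter $\mu$: $\xi_0(\mu,\bar\mu)$, $\eta_0(\mu,\bar\mu)$, $r_0(\mu,\bar\mu)$. Reflection: an oriented line with unit direction $v$ meeting $S$ at a point $p$ with unit normal $n$ is reflected to the oriented line through $p$ with direction $v-2(v\cdot n)n$. In coordinates, the incoming direction $\xi_1$, the normal direction $\xi_0$ and the reflected direction $\xi_2$ are related by $\xi_2=\frac{2\xi_0\bar\xi_1+1-\xi_0\bar\xi_0}{(1-\xi_0\bar\xi_0)\bar\xi_1-2\bar\xi_0}$. Point characteristic function: for an incoming ray $(\xi_1,\eta_1)$ through the point $p_1=(z_1,t_1)$ that is reflected in $S$ to a ray $(\xi_2,\eta_2)$ through the point $p_2=(z_2,t_2)$, $V$ takes the points $p_1$ and $p_2$ to the distance along the rays between $p_1$ and $p_2$ (via the reflection point). Points on the initial or final rays may lie on the opposite side of the surface, where the light never physically passes; the associated distances are then counted negatively. $V$ is defined only for those $(p_1,p_2)$ for which such a ray exists, and may be multivalued, since there may be more than one such ray. The sign $\pm$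 is an overall sign.
   Formalization: The formula for V is asserted only for rays arriving against the orienting normal (incoming direction · normal ≤ 0); for rays from the other side the r_0 term needs the opposite sign, and the printed formula is false there in general. *)

theory Defs
  imports "HOL-Analysis.Analysis"
begin

text \<open>
  Euclidean 3-space is \<^typ>\<open>complex \<times> real\<close>, a point being written \<open>(z, t)\<close> with
  \<open>z = x\<^sup>1 + \<i> x\<^sup>2\<close> and \<open>t = x\<^sup>3\<close>; the library inner product and norm of this product type
  are the Euclidean ones.  An oriented line whose direction is not the south direction is a
  pair \<open>(\<xi>, \<eta>)\<close> of complex numbers.
\<close>

type_synonym point = "complex \<times> real"
type_synonym oline = "complex \<times> complex"

definition dir :: "complex \<Rightarrow> point" where
  "dir \<xi> = (2 * \<xi> / of_real (1 + (cmod \<xi>)\<^sup>2), (1 - (cmod \<xi>)\<^sup>2) / (1 + (cmod \<xi>)\<^sup>2))"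

definition south :: point where
  "south = (0, -1)"

text \<open>The second component of \<open>\<Phi>\<close> is a real expression; \<^const>\<open>Re\<close> only changes its type.\<close>

definition Phi :: "oline \<times> real \<Rightarrow> point" where
  "Phi = (\<lambda>((\<xi>, \<eta>), r).
     ((2 * (\<eta> - cnj \<eta> * \<xi>\<^sup>2) + 2 * \<xi> * (1 + \<xi> * cnj \<xi>) * of_real r) / (1 + \<xi> * cnj \<xi>)\<^sup>2,
      Re ((- 2 * (\<eta> * cnj \<xi> + cnj \<eta> * \<xi>) + (1 - \<xi>\<^sup>2 * (cnj \<xi>)\<^sup>2) * of_real r)
          / (1 + \<xi> * cnj \<xi>)\<^sup>2)))"

definition pi1 :: "oline \<times> real \<Rightarrow> complex" where
  "pi1 = (\<lambda>((\<xi>, \<eta>), r). \<xi>)"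

definition on_line :: "point \<Rightarrow> oline \<Rightarrow> bool" where
  "on_line p L \<longleftrightarrow> (\<exists>r. Phi (L, r) = p)"

text \<open>
  An embedded \<open>C\<^sup>1\<close> surface \<open>S\<close>, given by local parametrisations \<open>X\<close> that are homeomorphisms onto
  relatively open pieces of \<open>S\<close> and \<open>C\<^sup>1\<close> immersions, with a continuous unit normal field \<open>N\<close>
  as its orientation.
\<close>

definition oriented_C1_surface :: "point set \<Rightarrow> (point \<Rightarrow> point) \<Rightarrow> bool" where
  "oriented_C1_surface S N \<longleftrightarrow>
     continuous_on S N \<and> (\<forall>p\<in>S. norm (N p) = 1) \<and>
     (\<forall>p\<in>S. \<exists>U W X Y. \<exists>X' :: complex \<Rightarrow> complex \<Rightarrow>\<^sub>L point.
        open U \<and> p \<in> U \<and> open W \<and> homeomorphism W (S \<inter> U) X Y \<and>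
        (\<forall>w\<in>W. (X has_derivative blinfun_apply (X' w)) (at w)) \<and>
        continuous_on W X' \<and>
        (\<forall>w\<in>W. inj (blinfun_apply (X' w)) \<and> (\<forall>h. blinfun_apply (X' w) h \<bullet> N (X w) = 0)))"

text \<open>The points of the surface whose normal lies in the coordinate patch.\<close>

definition patch :: "point set \<Rightarrow> (point \<Rightarrow> point) \<Rightarrow> point set" where
  "patch S N = {p \<in> S. N p \<noteq> south}"

text \<open>
  The map \<open>\<Phi>\<^sub>S\<^sup>-\<^sup>1\<close>, taking \<open>p\<close> to its oriented normal line and its position on that line.  Since
  \<open>\<Phi>\<close> is injective for fixed direction, the description is unique whenever \<open>N p\<close> is a unit vector
  other than \<^const>\<open>south\<close>.
\<close>

definition Phi_S_inv :: "(point \<Rightarrow> point) \<Rightarrow> point \<Rightarrow> oline \<times> real" where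
  "Phi_S_inv N p = (THE q. dir (pi1 q) = N p \<and> Phi q = p)"

definition parameterizes_normal_congruence ::
  "complex set \<Rightarrow> (complex \<Rightarrow> complex) \<Rightarrow> (complex \<Rightarrow> complex) \<Rightarrow> (complex \<Rightarrow> real)
   \<Rightarrow> point set \<Rightarrow> (point \<Rightarrow> point) \<Rightarrow> bool" where
  "parameterizes_normal_congruence M \<xi>0 \<eta>0 r0 S N \<longleftrightarrow>
     open M \<and> continuous_on M \<xi>0 \<and> continuous_on M \<eta>0 \<and> continuous_on M r0 \<and>
     (\<lambda>\<mu>. ((\<xi>0 \<mu>, \<eta>0 \<mu>), r0 \<mu>)) ` M = Phi_S_inv N ` patch S N"

definition reflect :: "point \<Rightarrow> point \<Rightarrow> point" where
  "reflect v n = v - (2 * (v \<bullet> n)) *\<^sub>R n"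

text \<open>
  The oriented line \<open>L1\<close> through \<open>p1\<close> meets \<open>S\<close> at \<open>p\<close> and is reflected there to the oriented line
  \<open>L2\<close> through \<open>p2\<close>.  The points \<open>p1\<close> and \<open>p2\<close> may lie anywhere on the two lines.
\<close>

definition reflected_ray ::
  "point set \<Rightarrow> (point \<Rightarrow> point) \<Rightarrow> point \<Rightarrow> oline \<Rightarrow> point \<Rightarrow> oline \<Rightarrow> point \<Rightarrow> bool" where
  "reflected_ray S N p1 L1 p L2 p2 \<longleftrightarrow>
     p \<in> patch S N \<and> on_line p1 L1 \<and> on_line p L1 \<and> on_line p L2 \<and> on_line p2 L2 \<and>
     dir (fst L2) = reflect (dir (fst L1)) (N p)"

text \<open>
  The distance from \<open>p\<close> to \<open>q\<close>, both on the oriented line \<open>L\<close>, counted negatively if \<open>q\<close> comes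
  before \<open>p\<close>.
\<close>

definition signed_dist :: "oline \<Rightarrow> point \<Rightarrow> point \<Rightarrow> real" where
  "signed_dist L p q =
     (if \<exists>r s. r \<le> s \<and> Phi (L, r) = p \<and> Phi (L, s) = q then dist p q else - dist p q)"

text \<open>
  The point characteristic function is multivalued and partially defined, hence a relation: \<open>V\<close> is
  its value at \<open>(p1, p2)\<close> on the branch belonging to the ray \<open>L1\<close> reflected at \<open>p\<close> to \<open>L2\<close>.
\<close>

definition point_characteristic ::
  "point set \<Rightarrow> (point \<Rightarrow> point) \<Rightarrow> point \<Rightarrow> oline \<Rightarrow> point \<Rightarrow> oline \<Rightarrow> point \<Rightarrow> real \<Rightarrow> bool" where
  "point_characteristic S N p1 L1 p L2 p2 V \<longleftrightarrow>
     reflected_ray S N p1 L1 p L2 p2 \<and> V = signed_dist L1 p1 p + signed_dist L2 p p2"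

text \<open>Numerator and denominator of the reflected direction \<open>\<xi>\<^sub>2\<close> in terms of \<open>\<xi>\<^sub>0\<close> and \<open>\<xi>\<^sub>1\<close>.\<close>

definition refl_num :: "complex \<Rightarrow> complex \<Rightarrow> complex" where
  "refl_num x0 x1 = 2 * x0 * cnj x1 + 1 - x0 * cnj x0"

definition refl_den :: "complex \<Rightarrow> complex \<Rightarrow> complex" where
  "refl_den x0 x1 = (1 - x0 * cnj x0) * cnj x1 - 2 * cnj x0"

definition s_coord :: "complex \<Rightarrow> point \<Rightarrow> complex" where
  "s_coord \<xi> = (\<lambda>(z, t).
     (cnj \<xi> * z + \<xi> * cnj z + (1 - \<xi> * cnj \<xi>) * of_real t) / (1 + \<xi> * cnj \<xi>))"

definition eq_final_ray :: "point \<Rightarrow> point \<Rightarrow> complex \<Rightarrow> real \<Rightarrow> complex \<Rightarrow> bool" where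
  "eq_final_ray p1 p2 x0 \<rho> x1 \<longleftrightarrow>
     (case p1 of (z1, t1) \<Rightarrow> case p2 of (z2, t2) \<Rightarrow>
        z2 * (refl_den x0 x1)\<^sup>2 - 2 * of_real t2 * refl_den x0 x1 * refl_num x0 x1
          - cnj z2 * (refl_num x0 x1)\<^sup>2
        = - ((1 + x0 * cnj x0)\<^sup>2 * (cnj z1 - 2 * of_real t1 * cnj x1 - z1 * (cnj x1)\<^sup>2))
          + 4 * (cnj x0 - cnj x1) * (1 + x0 * cnj x1) * (1 + x0 * cnj x0) * of_real \<rho>)"

definition eq_initial_ray :: "point \<Rightarrow> complex \<Rightarrow> complex \<Rightarrow> real \<Rightarrow> complex \<Rightarrow> bool" where
  "eq_initial_ray p1 x0 e0 \<rho> x1 \<longleftrightarrow>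
     (case p1 of (z1, t1) \<Rightarrow>
        (1 + x0 * cnj x0)\<^sup>2 * (z1 - 2 * of_real t1 * x1 - cnj z1 * x1\<^sup>2)
        = 2 * (1 + cnj x0 * x1)\<^sup>2 * e0 - 2 * (x0 - x1)\<^sup>2 * cnj e0
          + 2 * (1 + cnj x0 * x1) * (x0 - x1) * (1 + x0 * cnj x0) * of_real \<rho>)"

text \<open>The complex number inside \<^const>\<open>cmod\<close> is real, so this is an absolute value.\<close>

definition characteristic_abs ::
  "point \<Rightarrow> point \<Rightarrow> complex \<Rightarrow> complex \<Rightarrow> real \<Rightarrow> real" where
  "characteristic_abs p1 p2 \<xi>1 \<xi>2 \<rho> =
     cmod (s_coord \<xi>1 p1 - s_coord \<xi>2 p2
           + of_real (2 * cmod (\<xi>1 - \<xi>2)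
                      / sqrt ((1 + (cmod \<xi>1)\<^sup>2) * (1 + (cmod \<xi>2)\<^sup>2)) * \<rho>))"

end

theory Submission
  imports Defs
begin

text \<open>
  Fix a direction \<open>v = dir \<xi>\<close>.  Resolving a point \<open>p\<close> of space into its component along \<open>v\<close>, the
  inner product \<open>p \<bullet> v\<close>, and its component across \<open>v\<close>, the complex number
  \<open>2\<eta> = z - 2t\<xi> - cnj z \<xi>\<^sup>2\<close>, inverts the map \<^const>\<open>Phi\<close> (\<open>Phi_eq_iff\<close>).  In particular
  two points lie on a common line of direction \<open>\<xi>\<close> exactly when their values of \<open>2\<eta>\<close> agree, and
  signed distances on the line are differences of the components along \<open>v\<close>.

  The ray equations.  Stereographic projection turns the law of reflection into the stated
  fractional formula for \<open>\<xi>\<^sub>2\<close> (\<open>dir_eq_reflect_iff\<close>).  The equation for the initial ray says that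
  \<open>p1\<close> and the surface point \<open>p\<close> have the same \<open>2\<eta>\<close> with respect to \<open>\<xi>\<^sub>1\<close> (\<open>eq_initial_ray_iff\<close>).  That
  for the final ray says the same of \<open>p2\<close> and \<open>p\<close> with respect to \<open>\<xi>\<^sub>2\<close>, once the value for \<open>p\<close> has been expressed
  by the position of \<open>p\<close> across \<open>\<xi>\<^sub>1\<close>, which is that of \<open>p1\<close>, and the component \<open>r\<^sub>0\<close> of \<open>p\<close>
  along the normal (\<open>twice_eta_reflected\<close>, \<open>eq_final_ray_iff\<close>).  Solutions of the two equations
  are therefore precisely the reflected rays (\<open>reflected_ray_iff\<close>).

  The value.  With directions \<open>v\<^sub>1\<close>, \<open>v\<^sub>2\<close> and normal \<open>n\<close>, the signed path length is
  \<open>(p - p1) \<bullet> v\<^sub>1 + (p2 - p) \<bullet> v\<^sub>2 = - (s\<^sub>1 - s\<^sub>2 - p \<bullet> (v\<^sub>1 - v\<^sub>2))\<close>.  Since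
  \<open>v\<^sub>1 - v\<^sub>2 = 2 (v\<^sub>1 \<bullet> n) n\<close> and \<open>p \<bullet> n = r\<^sub>0\<close>, the last term is \<open>2 (v\<^sub>1 \<bullet> n) r\<^sub>0\<close>, and for
  \<open>v\<^sub>1 \<bullet> n \<le> 0\<close> the factor \<open>- 2 (v\<^sub>1 \<bullet> n)\<close> is the chordal distance of \<open>v\<^sub>1\<close> and \<open>v\<^sub>2\<close>, given in
  terms of \<open>\<xi>\<^sub>1\<close> and \<open>\<xi>\<^sub>2\<close> by \<open>norm_dir_diff\<close> (\<open>path_length_eq_characteristic_abs\<close>).
\<close>

section \<open>Directions and stereographic projection\<close>

lemma of_real_cmod_power2: "(complex_of_real (cmod \<xi>))\<^sup>2 = \<xi> * cnj \<xi>"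
  using complex_norm_square[of \<xi>] by simp

lemma one_plus_mult_cnj_neq_0: "1 + \<xi> * cnj \<xi> \<noteq> 0"
proof -
  have "1 + (cmod \<xi>)\<^sup>2 \<noteq> 0" by (smt (verit) zero_le_power2)
  then have "complex_of_real (1 + (cmod \<xi>)\<^sup>2) \<noteq> 0" by (simp only: of_real_eq_0_iff not_False_eq_True)
  then show ?thesis by (simp add: of_real_cmod_power2)
qed

lemma of_real_inner_point:
  "complex_of_real (p \<bullet> q)
     = (fst p * cnj (fst q) + cnj (fst p) * fst q) / 2 + of_real (snd p) * of_real (snd q)"
  by (simp add: inner_prod_def inner_complex_def complex_eq_iff)

lemma fst_dir: "fst (dir \<xi>) = 2 * \<xi> / (1 + \<xi> * cnj \<xi>)"
  by (simp add: dir_def of_real_cmod_power2)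

lemma of_real_snd_dir: "complex_of_real (snd (dir \<xi>)) = (1 - \<xi> * cnj \<xi>) / (1 + \<xi> * cnj \<xi>)"
  by (simp add: dir_def of_real_cmod_power2)

text \<open>
  Real identities are proved below after embedding them into the complex numbers, where
  \<open>\<xi>\<close> and \<open>cnj \<xi>\<close> behave as independent indeterminates; this turns inner products
  with directions into rational functions.
\<close>

lemma of_real_inner_dir:
  "complex_of_real (p \<bullet> dir \<xi>)
     = (fst p * cnj \<xi> + cnj (fst p) * \<xi> + (1 - \<xi> * cnj \<xi>) * of_real (snd p)) / (1 + \<xi> * cnj \<xi>)"
proof -
  define n where "n = 1 + \<xi> * cnj \<xi>"
  have n: "n \<noteq> 0" and "cnj n = n"
    using one_plus_mult_cnj_neq_0[of \<xi>] by (simp_all add: n_def mult.commute)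
  then show ?thesis
    unfolding of_real_inner_point fst_dir of_real_snd_dir n_def[symmetric]
    by (simp add: field_simps)
qed

lemma norm_dir: "norm (dir \<xi>) = 1"
proof -
  have "complex_of_real (dir \<xi> \<bullet> dir \<xi>) = of_real 1"
    using one_plus_mult_cnj_neq_0[of \<xi>]
    unfolding of_real_inner_dir fst_dir of_real_snd_dir
    by (simp add: divide_simps) (simp add: algebra_simps power2_eq_square)
  then have "dir \<xi> \<bullet> dir \<xi> = 1" unfolding of_real_eq_iff .
  then show ?thesis by (simp add: norm_eq_sqrt_inner)
qed

text \<open>
  The quotient is stereographic projection from the south pole.
\<close>

lemma south_projection_dir: "fst (dir \<xi>) / of_real (1 + snd (dir \<xi>)) = \<xi>"
proof -
  have "complex_of_real (1 + snd (dir \<xi>)) = 2 / (1 + \<xi> * cnj \<xi>)"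
    using one_plus_mult_cnj_neq_0[of \<xi>] by (simp add: of_real_snd_dir divide_simps)
  then show ?thesis
    using one_plus_mult_cnj_neq_0[of \<xi>] by (simp add: fst_dir)
qed

lemma inj_dir: "inj dir"
  by (metis injI south_projection_dir)

lemma dir_neq_south: "dir \<xi> \<noteq> south"
proof
  assume a: "dir \<xi> = south"
  have "\<xi> = 0" using south_projection_dir[of \<xi>] by (simp add: a south_def)
  then show False using a by (simp add: dir_def south_def)
qed

lemma dir_surjective:
  assumes "norm v = 1" "v \<noteq> south"
  obtains \<xi> where "dir \<xi> = v"
proof -
  obtain z t where v: "v = (z, t)" by fastforce
  have sq: "(cmod z)\<^sup>2 + t\<^sup>2 = 1"
    using assms(1) by (simp add: v norm_Pair real_sqrt_eq_1_iff)
  have t: "1 + t \<noteq> 0"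
  proof
    assume "1 + t = 0"
    then have "t = -1" by simp
    with sq assms(2) show False by (simp add: v south_def)
  qed
  have z: "(cmod z)\<^sup>2 = (1 + t) * (1 - t)" using sq by (simp add: algebra_simps power2_eq_square)
  have "(cmod (z / of_real (1 + t)))\<^sup>2 = (cmod z)\<^sup>2 / (1 + t)\<^sup>2"
    unfolding norm_divide norm_of_real power_divide power2_abs ..
  also have "\<dots> = (1 - t) / (1 + t)"
    unfolding z using t by (simp add: power2_eq_square)
  finally have m: "(cmod (z / of_real (1 + t)))\<^sup>2 = (1 - t) / (1 + t)" .
  \<comment> \<open>Half-angle formulas: \<open>1 + |\<xi>|\<^sup>2\<close> and \<open>1 - |\<xi>|\<^sup>2\<close> for the preimage \<open>\<xi> = z / (1 + t)\<close>.\<close>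
  have n: "1 + (1 - t) / (1 + t) = 2 / (1 + t)" using t by (simp add: divide_simps)
  have d: "1 - (1 - t) / (1 + t) = 2 * t / (1 + t)" using t by (simp add: divide_simps)
  have "complex_of_real (1 + t) \<noteq> 0" using t by (simp only: of_real_eq_0_iff not_False_eq_True)
  then have "dir (z / of_real (1 + t)) = v"
    unfolding dir_def m n d v using t by (simp add: divide_simps)
  then show thesis by (rule that)
qed

section \<open>Coordinates across and along a direction\<close>

text \<open>
  Twice the coordinate \<open>\<eta>\<close> of the line through \<open>p\<close> with direction \<open>\<xi>\<close>.  It is real linear in
  \<open>p\<close> and vanishes on \<^term>\<open>dir \<xi>\<close>, so it records the position of \<open>p\<close> modulo this
  direction; the factor 2 keeps it polynomial with integer coefficients, as in the ray equations.
\<close>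

definition twice_eta :: "complex \<Rightarrow> point \<Rightarrow> complex" where
  "twice_eta \<xi> p = fst p - 2 * of_real (snd p) * \<xi> - cnj (fst p) * \<xi>\<^sup>2"

text \<open>
  The quantities \<open>s\<^sub>i\<close> are the affine parameters of the points on their rays.
\<close>

lemma s_coord_eq_inner: "s_coord \<xi> p = of_real (p \<bullet> dir \<xi>)"
  by (cases p) (simp add: s_coord_def of_real_inner_dir mult.commute)

lemma fst_Phi:
  "fst (Phi ((\<xi>, \<eta>), r)) =
     (2 * (\<eta> - cnj \<eta> * \<xi>\<^sup>2) + 2 * \<xi> * (1 + \<xi> * cnj \<xi>) * of_real r) / (1 + \<xi> * cnj \<xi>)\<^sup>2"
  by (simp add: Phi_def)

lemma of_real_snd_Phi:
  "complex_of_real (snd (Phi ((\<xi>, \<eta>), r))) =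
     (- 2 * (\<eta> * cnj \<xi> + cnj \<eta> * \<xi>) + (1 - \<xi>\<^sup>2 * (cnj \<xi>)\<^sup>2) * of_real r) / (1 + \<xi> * cnj \<xi>)\<^sup>2"
  (is "_ = ?t")
proof -
  have "cnj ?t = ?t" by (simp add: mult.commute add.commute)
  then have "complex_of_real (Re ?t) = ?t" by (metis Reals_cnj_iff of_real_Re)
  then show ?thesis by (simp add: Phi_def)
qed

lemma twice_eta_Phi: "twice_eta \<xi> (Phi ((\<xi>, \<eta>), r)) = 2 * \<eta>"
  using one_plus_mult_cnj_neq_0[of \<xi>]
  unfolding twice_eta_def fst_Phi of_real_snd_Phi
  by (simp add: divide_simps mult.commute) (simp add: algebra_simps power2_eq_square)

lemma inner_Phi_dir: "Phi ((\<xi>, \<eta>), r) \<bullet> dir \<xi> = r"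
proof -
  have "complex_of_real (Phi ((\<xi>, \<eta>), r) \<bullet> dir \<xi>) = of_real r"
    using one_plus_mult_cnj_neq_0[of \<xi>]
    unfolding of_real_inner_dir fst_Phi of_real_snd_Phi
    by (simp add: divide_simps mult.commute) (simp add: algebra_simps power2_eq_square)
  then show ?thesis by simp
qed

lemma Phi_twice_eta_inner: "Phi ((\<xi>, twice_eta \<xi> p / 2), p \<bullet> dir \<xi>) = p"
proof -
  have twice: "2 + \<xi> * (cnj \<xi> * 2) \<noteq> 0"
    using mult_eq_0_iff[of 2 "1 + \<xi> * cnj \<xi>"] one_plus_mult_cnj_neq_0[of \<xi>]
    by (simp add: algebra_simps)
  have "fst (Phi ((\<xi>, twice_eta \<xi> p / 2), p \<bullet> dir \<xi>)) = fst p"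
    using one_plus_mult_cnj_neq_0[of \<xi>] twice
    unfolding of_real_inner_dir fst_Phi twice_eta_def
    by (simp add: divide_simps mult.commute) (simp add: algebra_simps power2_eq_square)
  moreover have "complex_of_real (snd (Phi ((\<xi>, twice_eta \<xi> p / 2), p \<bullet> dir \<xi>))) = of_real (snd p)"
    using one_plus_mult_cnj_neq_0[of \<xi>] twice
    unfolding of_real_inner_dir of_real_snd_Phi twice_eta_def
    by (simp add: divide_simps mult.commute) (simp add: algebra_simps power2_eq_square)
  ultimately show ?thesis by (simp add: prod_eq_iff)
qed

text \<open>
  For a fixed direction, \<^const>\<open>Phi\<close> is a real linear change of coordinates on space: a point is
  resolved into its component across the direction (\<^const>\<open>twice_eta\<close>) and its component along it.
  Everything said about lines is reduced to these two components.
\<close>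

lemma Phi_eq_iff: "Phi ((\<xi>, \<eta>), r) = p \<longleftrightarrow> \<eta> = twice_eta \<xi> p / 2 \<and> r = p \<bullet> dir \<xi>"
  by (metis twice_eta_Phi inner_Phi_dir Phi_twice_eta_inner nonzero_mult_div_cancel_left zero_neq_numeral)

lemma on_line_iff: "on_line p (\<xi>, \<eta>) \<longleftrightarrow> \<eta> = twice_eta \<xi> p / 2"
  unfolding on_line_def Phi_eq_iff by simp

lemma Phi_diff_same_line: "Phi ((\<xi>, \<eta>), r) - Phi ((\<xi>, \<eta>), s) = (r - s) *\<^sub>R dir \<xi>"
proof -
  have "fst (Phi ((\<xi>, \<eta>), r)) - fst (Phi ((\<xi>, \<eta>), s)) = of_real (r - s) * fst (dir \<xi>)"
    using one_plus_mult_cnj_neq_0[of \<xi>]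
    unfolding fst_Phi fst_dir
    by (simp add: divide_simps) (simp add: algebra_simps power2_eq_square)
  moreover have "complex_of_real (snd (Phi ((\<xi>, \<eta>), r)) - snd (Phi ((\<xi>, \<eta>), s)))
      = of_real ((r - s) * snd (dir \<xi>))"
    using one_plus_mult_cnj_neq_0[of \<xi>]
    unfolding of_real_diff of_real_mult of_real_snd_Phi of_real_snd_dir
    by (simp add: divide_simps) (simp add: algebra_simps power2_eq_square)
  ultimately show ?thesis
    unfolding of_real_eq_iff by (simp add: prod_eq_iff scaleR_conv_of_real)
qed

lemma signed_dist_eq_inner:
  assumes "on_line p (\<xi>, \<eta>)" "on_line q (\<xi>, \<eta>)"
  shows "signed_dist (\<xi>, \<eta>) p q = (q - p) \<bullet> dir \<xi>"
proof -
  define a b where "a = p \<bullet> dir \<xi>" and "b = q \<bullet> dir \<xi>"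
  have p: "Phi ((\<xi>, \<eta>), r) = p \<longleftrightarrow> r = a" and q: "Phi ((\<xi>, \<eta>), r) = q \<longleftrightarrow> r = b" for r
    using assms unfolding on_line_iff Phi_eq_iff a_def b_def by auto
  have "dist p q = \<bar>a - b\<bar>"
    using Phi_diff_same_line[of \<xi> \<eta> a b] p[of a] q[of b]
    by (simp add: dist_norm norm_dir)
  then show ?thesis
    unfolding signed_dist_def p q by (auto simp: inner_diff_left a_def[symmetric] b_def[symmetric])
qed

text \<open>
  The definite description is resolved by the bijectivity of \<^const>\<open>dir\<close> onto the sphere minus the
  south pole together with that of \<^const>\<open>Phi\<close> for the direction found.
\<close>

lemma Phi_S_inv_eq_iff:
  assumes "norm (N p) = 1" "N p \<noteq> south"
  shows "Phi_S_inv N p = q \<longleftrightarrow> dir (pi1 q) = N p \<and> Phi q = p"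
proof -
  obtain \<xi> where \<xi>: "dir \<xi> = N p" using dir_surjective assms by metis
  define q0 where "q0 = ((\<xi>, twice_eta \<xi> p / 2), p \<bullet> dir \<xi>)"
  have *: "dir (pi1 q) = N p \<and> Phi q = p \<longleftrightarrow> q = q0" for q
  proof -
    obtain x e r where q: "q = ((x, e), r)" by (metis surj_pair)
    have "dir x = N p \<longleftrightarrow> x = \<xi>" using \<xi> inj_dir by (metis injD)
    then show ?thesis by (auto simp: q q0_def pi1_def Phi_eq_iff)
  qed
  show ?thesis unfolding Phi_S_inv_def * by auto
qed

section \<open>The law of reflection\<close>

text \<open>
  The pair \<open>(refl_den, refl_num)\<close> gives homogeneous coordinates of the reflected direction on the
  projective line.  Its squared length is the common denominator of that direction, and being
  positive it excludes a common zero of the two.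
\<close>

lemma refl_den_num_norm:
  "(cmod (refl_den x0 x1))\<^sup>2 + (cmod (refl_num x0 x1))\<^sup>2
     = (1 + (cmod x0)\<^sup>2)\<^sup>2 * (1 + (cmod x1)\<^sup>2)"
proof -
  have "complex_of_real ((cmod (refl_den x0 x1))\<^sup>2 + (cmod (refl_num x0 x1))\<^sup>2)
     = of_real ((1 + (cmod x0)\<^sup>2)\<^sup>2 * (1 + (cmod x1)\<^sup>2))"
    by (simp add: of_real_cmod_power2 refl_den_def refl_num_def)
      (simp add: algebra_simps power2_eq_square)
  then show ?thesis unfolding of_real_eq_iff .
qed

lemma reflect_dir_homogeneous:
  fixes x0 x1 :: complex
  defines "a \<equiv> refl_den x0 x1" and "b \<equiv> refl_num x0 x1"
  shows "reflect (dir x1) (dir x0) =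
    (2 * cnj a * b / of_real ((cmod a)\<^sup>2 + (cmod b)\<^sup>2),
     ((cmod a)\<^sup>2 - (cmod b)\<^sup>2) / ((cmod a)\<^sup>2 + (cmod b)\<^sup>2))"
proof -
  define m where "m = dir x1 \<bullet> dir x0"
  note ne = one_plus_mult_cnj_neq_0[of x0] one_plus_mult_cnj_neq_0[of x1]
  have m: "complex_of_real m = (2 * x1 * cnj x0 + 2 * cnj x1 * x0
        + (1 - x0 * cnj x0) * (1 - x1 * cnj x1)) / ((1 + x0 * cnj x0) * (1 + x1 * cnj x1))"
    using ne unfolding m_def of_real_inner_dir fst_dir of_real_snd_dir
    by (simp add: divide_simps mult.commute)
  have z: "fst (reflect (dir x1) (dir x0)) = fst (dir x1) - 2 * of_real m * fst (dir x0)"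
    and t: "complex_of_real (snd (reflect (dir x1) (dir x0)))
      = of_real (snd (dir x1)) - 2 * of_real m * of_real (snd (dir x0))"
    by (simp_all add: reflect_def m_def scaleR_conv_of_real)
  have "fst (reflect (dir x1) (dir x0)) = 2 * cnj a * b / of_real ((cmod a)\<^sup>2 + (cmod b)\<^sup>2)"
    using ne unfolding z m fst_dir a_def b_def refl_den_num_norm
    by (simp add: of_real_cmod_power2 divide_simps refl_den_def refl_num_def)
      (simp add: algebra_simps power2_eq_square)
  moreover have "complex_of_real (snd (reflect (dir x1) (dir x0)))
      = of_real (((cmod a)\<^sup>2 - (cmod b)\<^sup>2) / ((cmod a)\<^sup>2 + (cmod b)\<^sup>2))"
    using ne unfolding t m of_real_snd_dir a_def b_def refl_den_num_norm
    by (simp add: of_real_cmod_power2 divide_simps refl_den_def refl_num_def)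
      (simp add: algebra_simps power2_eq_square)
  ultimately show ?thesis unfolding of_real_eq_iff by (simp add: prod_eq_iff)
qed

lemma dir_quotient:
  assumes "a \<noteq> 0"
  shows "dir (b / a) =
    (2 * cnj a * b / of_real ((cmod a)\<^sup>2 + (cmod b)\<^sup>2),
     ((cmod a)\<^sup>2 - (cmod b)\<^sup>2) / ((cmod a)\<^sup>2 + (cmod b)\<^sup>2))"
proof -
  have pos: "(cmod a)\<^sup>2 > 0" using assms by simp
  have s: "1 + (cmod (b / a))\<^sup>2 = ((cmod a)\<^sup>2 + (cmod b)\<^sup>2) / (cmod a)\<^sup>2"
    and d: "1 - (cmod (b / a))\<^sup>2 = ((cmod a)\<^sup>2 - (cmod b)\<^sup>2) / (cmod a)\<^sup>2"
    using pos by (simp_all add: norm_divide power_divide divide_simps)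
  have "2 * (b / a) * of_real ((cmod a)\<^sup>2) = 2 * cnj a * b"
    using assms by (simp add: of_real_cmod_power2)
  then have z: "2 * (b / a) / of_real (((cmod a)\<^sup>2 + (cmod b)\<^sup>2) / (cmod a)\<^sup>2)
      = 2 * cnj a * b / of_real ((cmod a)\<^sup>2 + (cmod b)\<^sup>2)"
    by (simp only: of_real_divide divide_divide_eq_right)
  show ?thesis unfolding dir_def s d z using pos by simp
qed

text \<open>
  The law of reflection on the Riemann sphere.  The denominator vanishes exactly when the reflected
  ray points south, out of the coordinate patch; hence the condition that it be nonzero.
\<close>

lemma dir_eq_reflect_iff:
  "dir \<xi> = reflect (dir x1) (dir x0)
     \<longleftrightarrow> refl_den x0 x1 \<noteq> 0 \<and> \<xi> = refl_num x0 x1 / refl_den x0 x1"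
proof (cases "refl_den x0 x1 = 0")
  case True
  have "(1 + (cmod x0)\<^sup>2)\<^sup>2 * (1 + (cmod x1)\<^sup>2) > 0"
    by (intro mult_pos_pos zero_less_power add_pos_nonneg) simp_all
  then have "refl_num x0 x1 \<noteq> 0"
    using refl_den_num_norm[of x0 x1] True by auto
  then have "reflect (dir x1) (dir x0) = south"
    unfolding reflect_dir_homogeneous True by (simp add: south_def)
  then show ?thesis using True dir_neq_south by simp
next
  case False
  then have "reflect (dir x1) (dir x0) = dir (refl_num x0 x1 / refl_den x0 x1)"
    unfolding reflect_dir_homogeneous by (simp only: dir_quotient[OF False])
  then show ?thesis using False inj_dir by (metis injD)
qed

section \<open>The ray equations\<close>

text \<open>
  This identity is the source of the equation for the final ray.  Both sides are real linear in
  \<open>p\<close>.  Reflection fixes the plane through the origin perpendicular to \<^term>\<open>dir x0\<close>, where the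
  outgoing position is, up to a complex factor, the negative conjugate of the incoming one; the term with
  \<^term>\<open>p \<bullet> dir x0\<close> corrects for the offset of \<open>p\<close> along the normal.
\<close>

lemma twice_eta_reflected:
  assumes "refl_den x0 x1 \<noteq> 0"
  shows "(refl_den x0 x1)\<^sup>2 * twice_eta (refl_num x0 x1 / refl_den x0 x1) p
    = - ((1 + x0 * cnj x0)\<^sup>2 * cnj (twice_eta x1 p))
      + 4 * (cnj x0 - cnj x1) * (1 + x0 * cnj x1) * (1 + x0 * cnj x0) * of_real (p \<bullet> dir x0)"
proof -
  have "(1 + x0 * cnj x0) * of_real (p \<bullet> dir x0)
      = fst p * cnj x0 + cnj (fst p) * x0 + (1 - x0 * cnj x0) * of_real (snd p)"
    using one_plus_mult_cnj_neq_0[of x0] by (simp add: of_real_inner_dir)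
  then have r: "4 * (cnj x0 - cnj x1) * (1 + x0 * cnj x1) * (1 + x0 * cnj x0) * of_real (p \<bullet> dir x0)
      = 4 * (cnj x0 - cnj x1) * (1 + x0 * cnj x1)
        * (fst p * cnj x0 + cnj (fst p) * x0 + (1 - x0 * cnj x0) * of_real (snd p))"
    by (simp only: mult.assoc)
  define \<xi>2 where "\<xi>2 = refl_num x0 x1 / refl_den x0 x1"
  have n: "refl_num x0 x1 = \<xi>2 * refl_den x0 x1" using assms by (simp add: \<xi>2_def)
  have "(refl_den x0 x1)\<^sup>2 * twice_eta \<xi>2 p
      = fst p * (refl_den x0 x1)\<^sup>2 - 2 * of_real (snd p) * refl_den x0 x1 * refl_num x0 x1
        - cnj (fst p) * (refl_num x0 x1)\<^sup>2"
    unfolding n by (simp add: twice_eta_def algebra_simps power2_eq_square)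
  also have "\<dots> = - ((1 + x0 * cnj x0)\<^sup>2 * cnj (twice_eta x1 p))
      + 4 * (cnj x0 - cnj x1) * (1 + x0 * cnj x1)
        * (fst p * cnj x0 + cnj (fst p) * x0 + (1 - x0 * cnj x0) * of_real (snd p))"
    by (simp add: twice_eta_def refl_den_def refl_num_def) (simp add: algebra_simps power2_eq_square)
  finally show ?thesis unfolding r \<xi>2_def .
qed

text \<open>
  The equation for the initial ray says that \<open>p1\<close> lies on the line with direction \<open>x1\<close> through the surface
  point.
\<close>

lemma eq_initial_ray_iff:
  "eq_initial_ray p1 x0 e0 \<rho> x1 \<longleftrightarrow> twice_eta x1 p1 = twice_eta x1 (Phi ((x0, e0), \<rho>))"
proof -
  note ne = one_plus_mult_cnj_neq_0[of x0]
  have "(1 + x0 * cnj x0)\<^sup>2 * twice_eta x1 (Phi ((x0, e0), \<rho>))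
    = 2 * (1 + cnj x0 * x1)\<^sup>2 * e0 - 2 * (x0 - x1)\<^sup>2 * cnj e0
          + 2 * (1 + cnj x0 * x1) * (x0 - x1) * (1 + x0 * cnj x0) * of_real \<rho>"
    using ne unfolding twice_eta_def fst_Phi of_real_snd_Phi
    by (simp add: divide_simps mult.commute) (simp add: algebra_simps power2_eq_square)
  moreover have "eq_initial_ray p1 x0 e0 \<rho> x1 \<longleftrightarrow>
      (1 + x0 * cnj x0)\<^sup>2 * twice_eta x1 p1
    = 2 * (1 + cnj x0 * x1)\<^sup>2 * e0 - 2 * (x0 - x1)\<^sup>2 * cnj e0
          + 2 * (1 + cnj x0 * x1) * (x0 - x1) * (1 + x0 * cnj x0) * of_real \<rho>"
    by (cases p1) (simp add: eq_initial_ray_def twice_eta_def)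
  ultimately show ?thesis using ne by (metis mult_cancel_left power_eq_0_iff)
qed

text \<open>
  Given that \<open>p1\<close> lies on the incoming line through the surface point \<open>p\<close>, the equation
  for the final ray says that \<open>p2\<close> lies on the reflected line through \<open>p\<close>: by linearity the unknown
  position of \<open>p\<close> across the incoming ray can be read off from \<open>p1\<close>.
\<close>

lemma eq_final_ray_iff:
  assumes den: "refl_den x0 x1 \<noteq> 0"
    and p: "twice_eta x1 p = twice_eta x1 p1" "p \<bullet> dir x0 = \<rho>"
  shows "eq_final_ray p1 p2 x0 \<rho> x1 \<longleftrightarrow>
    twice_eta (refl_num x0 x1 / refl_den x0 x1) p2 = twice_eta (refl_num x0 x1 / refl_den x0 x1) p"
proof -
  define \<xi>2 where "\<xi>2 = refl_num x0 x1 / refl_den x0 x1"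
  have n: "refl_num x0 x1 = \<xi>2 * refl_den x0 x1" using den by (simp add: \<xi>2_def)
  obtain z1 t1 z2 t2 where p12: "p1 = (z1, t1)" "p2 = (z2, t2)" by fastforce
  have l: "z2 * (refl_den x0 x1)\<^sup>2 - 2 * of_real t2 * refl_den x0 x1 * refl_num x0 x1
          - cnj z2 * (refl_num x0 x1)\<^sup>2 = (refl_den x0 x1)\<^sup>2 * twice_eta \<xi>2 p2"
    unfolding n by (simp add: p12 twice_eta_def algebra_simps power2_eq_square)
  have c: "cnj z1 - 2 * of_real t1 * cnj x1 - z1 * (cnj x1)\<^sup>2 = cnj (twice_eta x1 p)"
    unfolding p(1) by (simp add: p12 twice_eta_def)
  have "eq_final_ray p1 p2 x0 \<rho> x1 \<longleftrightarrow>
      (refl_den x0 x1)\<^sup>2 * twice_eta \<xi>2 p2 = (refl_den x0 x1)\<^sup>2 * twice_eta \<xi>2 p"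
    unfolding twice_eta_reflected[OF den, of p, folded \<xi>2_def, unfolded p(2)]
      l[symmetric] c[symmetric]
    by (simp add: eq_final_ray_def p12)
  then show ?thesis using den by (simp add: \<xi>2_def)
qed

lemma reflected_ray_iff:
  assumes N: "N p = dir x0" and p: "p = Phi ((x0, e0), \<rho>)" and S: "p \<in> patch S N"
  shows "reflected_ray S N p1 (\<xi>1, \<eta>1) p (\<xi>2, \<eta>2) p2 \<longleftrightarrow>
    \<eta>1 = twice_eta \<xi>1 p / 2 \<and> \<eta>2 = twice_eta \<xi>2 p / 2 \<and>
    eq_final_ray p1 p2 x0 \<rho> \<xi>1 \<and> eq_initial_ray p1 x0 e0 \<rho> \<xi>1 \<and>
    refl_den x0 \<xi>1 \<noteq> 0 \<and> \<xi>2 = refl_num x0 \<xi>1 / refl_den x0 \<xi>1"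
proof -
  have \<rho>: "p \<bullet> dir x0 = \<rho>" by (simp add: p inner_Phi_dir)
  have i: "eq_initial_ray p1 x0 e0 \<rho> \<xi>1 \<longleftrightarrow> twice_eta \<xi>1 p = twice_eta \<xi>1 p1"
    unfolding p eq_initial_ray_iff by auto
  have f: "eq_final_ray p1 p2 x0 \<rho> \<xi>1 \<longleftrightarrow> twice_eta \<xi>2 p2 = twice_eta \<xi>2 p"
    if "refl_den x0 \<xi>1 \<noteq> 0" "\<xi>2 = refl_num x0 \<xi>1 / refl_den x0 \<xi>1" "twice_eta \<xi>1 p = twice_eta \<xi>1 p1"
    using eq_final_ray_iff[OF that(1) that(3) \<rho>] that(2) by simp
  show ?thesis
    unfolding reflected_ray_def on_line_iff N fst_conv dir_eq_reflect_iff i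
    using S f by auto
qed

section \<open>Path length\<close>

text \<open>
  The chordal metric of stereographic projection; it accounts for the coefficient of \<open>r\<^sub>0\<close> in
  the characteristic function.
\<close>

lemma norm_dir_diff:
  "norm (dir \<xi>1 - dir \<xi>2) = 2 * cmod (\<xi>1 - \<xi>2) / sqrt ((1 + (cmod \<xi>1)\<^sup>2) * (1 + (cmod \<xi>2)\<^sup>2))"
proof -
  note ne = one_plus_mult_cnj_neq_0[of \<xi>1] one_plus_mult_cnj_neq_0[of \<xi>2]
  have "complex_of_real (2 - 2 * (dir \<xi>1 \<bullet> dir \<xi>2))
    = of_real (4 * (cmod (\<xi>1 - \<xi>2))\<^sup>2 / ((1 + (cmod \<xi>1)\<^sup>2) * (1 + (cmod \<xi>2)\<^sup>2)))"
    unfolding of_real_diff of_real_mult of_real_inner_dir fst_dir of_real_snd_dir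
    using ne
    by (simp add: of_real_cmod_power2 divide_simps mult.commute) (simp add: algebra_simps)
  then have "2 - 2 * (dir \<xi>1 \<bullet> dir \<xi>2)
      = 4 * (cmod (\<xi>1 - \<xi>2))\<^sup>2 / ((1 + (cmod \<xi>1)\<^sup>2) * (1 + (cmod \<xi>2)\<^sup>2))"
    unfolding of_real_eq_iff .
  moreover have "(norm (dir \<xi>1 - dir \<xi>2))\<^sup>2 = 2 - 2 * (dir \<xi>1 \<bullet> dir \<xi>2)"
    using norm_dir[of \<xi>1] norm_dir[of \<xi>2]
    by (simp add: power2_norm_eq_inner inner_diff inner_commute norm_eq_1)
  ultimately have "norm (dir \<xi>1 - dir \<xi>2)
      = sqrt (4 * (cmod (\<xi>1 - \<xi>2))\<^sup>2 / ((1 + (cmod \<xi>1)\<^sup>2) * (1 + (cmod \<xi>2)\<^sup>2)))"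
    by (metis norm_ge_zero real_sqrt_unique)
  then show ?thesis by (simp add: real_sqrt_divide real_sqrt_mult)
qed

text \<open>
  Since \<open>p\<close> enters the path length only through its inner product with \<^term>\<open>dir \<xi>1 - dir \<xi>2\<close>,
  and this vector is a multiple of the normal, only the normal component of \<open>p\<close> matters.  The
  condition that the ray arrives against the normal fixes the sign of that multiple, so that it can
  be replaced by the chordal distance; for the opposite sign the \<open>r\<^sub>0\<close> term would be subtracted.
\<close>

lemma path_length_eq_characteristic_abs:
  assumes refl: "dir \<xi>2 = reflect (dir \<xi>1) (dir \<xi>0)"
    and front: "dir \<xi>1 \<bullet> dir \<xi>0 \<le> 0"
    and V: "V = (p - p1) \<bullet> dir \<xi>1 + (p2 - p) \<bullet> dir \<xi>2"
  shows "V = characteristic_abs p1 p2 \<xi>1 \<xi>2 (p \<bullet> dir \<xi>0)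
    \<or> V = - characteristic_abs p1 p2 \<xi>1 \<xi>2 (p \<bullet> dir \<xi>0)"
proof -
  have turn: "dir \<xi>1 - dir \<xi>2 = (2 * (dir \<xi>1 \<bullet> dir \<xi>0)) *\<^sub>R dir \<xi>0"
    by (simp add: refl reflect_def)
  \<comment> \<open>The sign condition decides the absolute value of the factor.\<close>
  then have "norm (dir \<xi>1 - dir \<xi>2) = - 2 * (dir \<xi>1 \<bullet> dir \<xi>0)"
    using front by (simp add: norm_dir)
  moreover have "p \<bullet> dir \<xi>1 - p \<bullet> dir \<xi>2 = 2 * (dir \<xi>1 \<bullet> dir \<xi>0) * (p \<bullet> dir \<xi>0)"
    using arg_cong[OF turn, of "\<lambda>x. p \<bullet> x"] by (simp add: inner_diff_right)
  ultimately have "V = - (p1 \<bullet> dir \<xi>1 - p2 \<bullet> dir \<xi>2 + norm (dir \<xi>1 - dir \<xi>2) * (p \<bullet> dir \<xi>0))"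
    by (simp add: V inner_diff_left)
  moreover have "characteristic_abs p1 p2 \<xi>1 \<xi>2 (p \<bullet> dir \<xi>0)
      = \<bar>p1 \<bullet> dir \<xi>1 - p2 \<bullet> dir \<xi>2 + norm (dir \<xi>1 - dir \<xi>2) * (p \<bullet> dir \<xi>0)\<bar>"
    unfolding characteristic_abs_def norm_dir_diff[symmetric] s_coord_eq_inner
      of_real_diff[symmetric] of_real_add[symmetric] norm_of_real ..
  ultimately show ?thesis by linarith
qed

section \<open>Surface points and parameters\<close>

text \<open>
  The next two lemmas pass between parameter values and surface points: the parameterization and
  \<^const>\<open>Phi_S_inv\<close> have the same image, and \<^const>\<open>Phi\<close> recovers the point from it.
\<close>

lemma normal_congruence_point:
  assumes surface: "oriented_C1_surface S N"
    and param: "parameterizes_normal_congruence M \<xi>0 \<eta>0 r0 S N"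
    and \<mu>: "\<mu> \<in> M"
  defines "p \<equiv> Phi ((\<xi>0 \<mu>, \<eta>0 \<mu>), r0 \<mu>)"
  shows "p \<in> patch S N" "N p = dir (\<xi>0 \<mu>)"
proof -
  have "((\<xi>0 \<mu>, \<eta>0 \<mu>), r0 \<mu>) \<in> Phi_S_inv N ` patch S N"
    using param \<mu> unfolding parameterizes_normal_congruence_def by blast
  then obtain q where q: "q \<in> patch S N" "Phi_S_inv N q = ((\<xi>0 \<mu>, \<eta>0 \<mu>), r0 \<mu>)" by fastforce
  moreover have "norm (N q) = 1" "N q \<noteq> south"
    using surface q(1) by (auto simp: oriented_C1_surface_def patch_def)
  ultimately have "dir (\<xi>0 \<mu>) = N q" "p = q"
    by (simp_all add: Phi_S_inv_eq_iff p_def pi1_def)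
  with q(1) show "p \<in> patch S N" "N p = dir (\<xi>0 \<mu>)" by simp_all
qed

lemma normal_congruence_parameter:
  assumes surface: "oriented_C1_surface S N"
    and param: "parameterizes_normal_congruence M \<xi>0 \<eta>0 r0 S N"
    and p: "p \<in> patch S N"
  obtains \<mu> where "\<mu> \<in> M" "p = Phi ((\<xi>0 \<mu>, \<eta>0 \<mu>), r0 \<mu>)" "N p = dir (\<xi>0 \<mu>)"
    "\<xi>0 \<mu> \<in> (pi1 \<circ> Phi_S_inv N) ` patch S N"
proof -
  have "Phi_S_inv N p \<in> (\<lambda>\<mu>. ((\<xi>0 \<mu>, \<eta>0 \<mu>), r0 \<mu>)) ` M"
    using param p unfolding parameterizes_normal_congruence_def by blast
  then obtain \<mu> where \<mu>: "\<mu> \<in> M" "Phi_S_inv N p = ((\<xi>0 \<mu>, \<eta>0 \<mu>), r0 \<mu>)" by fastforce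
  have "norm (N p) = 1" "N p \<noteq> south"
    using surface p by (auto simp: oriented_C1_surface_def patch_def)
  with \<mu>(2) have "dir (\<xi>0 \<mu>) = N p" "Phi ((\<xi>0 \<mu>, \<eta>0 \<mu>), r0 \<mu>) = p"
    by (simp_all add: Phi_S_inv_eq_iff pi1_def)
  moreover have "\<xi>0 \<mu> \<in> (pi1 \<circ> Phi_S_inv N) ` patch S N"
    using p \<mu>(2) by (intro image_eqI[of _ _ p]) (simp_all add: pi1_def)
  ultimately show thesis using \<mu>(1) that by simp
qed

lemma point_characteristic_eq:
  assumes "point_characteristic S N p1 (\<xi>1, \<eta>1) p (\<xi>2, \<eta>2) p2 V"
  shows "V = (p - p1) \<bullet> dir \<xi>1 + (p2 - p) \<bullet> dir \<xi>2"
  using assms unfolding point_characteristic_def reflected_ray_def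
  by (simp add: signed_dist_eq_inner)

lemma point_characteristic_abs:
  assumes V: "point_characteristic S N p1 (\<xi>1, \<eta>1) p (\<xi>2, \<eta>2) p2 V"
    and N: "N p = dir x0" and p: "p = Phi ((x0, e0), \<rho>)"
    and front: "dir \<xi>1 \<bullet> dir x0 \<le> 0"
  shows "V = characteristic_abs p1 p2 \<xi>1 \<xi>2 \<rho> \<or> V = - characteristic_abs p1 p2 \<xi>1 \<xi>2 \<rho>"
proof -
  have refl: "dir \<xi>2 = reflect (dir \<xi>1) (dir x0)"
    using V N by (simp add: point_characteristic_def reflected_ray_def)
  have "p \<bullet> dir x0 = \<rho>" by (simp add: p inner_Phi_dir)
  then show ?thesis
    using path_length_eq_characteristic_abs[OF refl front point_characteristic_eq[OF V]] by simp
qed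

section \<open>The point characteristic function\<close>

theorem theorem5:
  fixes S :: "point set" and N :: "point \<Rightarrow> point"
    and M :: "complex set" and \<xi>0 \<eta>0 :: "complex \<Rightarrow> complex" and r0 :: "complex \<Rightarrow> real"
  assumes surface: "oriented_C1_surface S N"
    and param: "parameterizes_normal_congruence M \<xi>0 \<eta>0 r0 S N"
  shows
    "(\<forall>p1 p2 \<xi>1 \<eta>1 p \<xi>2 \<eta>2 V.
        point_characteristic S N p1 (\<xi>1, \<eta>1) p (\<xi>2, \<eta>2) p2 V \<longrightarrow>
        (\<exists>\<mu>\<in>M. p = Phi ((\<xi>0 \<mu>, \<eta>0 \<mu>), r0 \<mu>) \<and> N p = dir (\<xi>0 \<mu>) \<and>
           \<xi>0 \<mu> \<in> (pi1 \<circ> Phi_S_inv N) ` patch S N \<and>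
           eq_final_ray p1 p2 (\<xi>0 \<mu>) (r0 \<mu>) \<xi>1 \<and>
           eq_initial_ray p1 (\<xi>0 \<mu>) (\<eta>0 \<mu>) (r0 \<mu>) \<xi>1 \<and>
           refl_den (\<xi>0 \<mu>) \<xi>1 \<noteq> 0 \<and>
           \<xi>2 = refl_num (\<xi>0 \<mu>) \<xi>1 / refl_den (\<xi>0 \<mu>) \<xi>1 \<and>
           (dir \<xi>1 \<bullet> dir (\<xi>0 \<mu>) \<le> 0 \<longrightarrow>
              V = characteristic_abs p1 p2 \<xi>1 \<xi>2 (r0 \<mu>) \<or>
              V = - characteristic_abs p1 p2 \<xi>1 \<xi>2 (r0 \<mu>))))
     \<and>
     (\<forall>p1 p2 \<xi>1 \<xi>2. \<forall>\<mu>\<in>M.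
        \<xi>0 \<mu> \<in> (pi1 \<circ> Phi_S_inv N) ` patch S N \<and>
        eq_final_ray p1 p2 (\<xi>0 \<mu>) (r0 \<mu>) \<xi>1 \<and>
        eq_initial_ray p1 (\<xi>0 \<mu>) (\<eta>0 \<mu>) (r0 \<mu>) \<xi>1 \<and>
        refl_den (\<xi>0 \<mu>) \<xi>1 \<noteq> 0 \<and>
        \<xi>2 = refl_num (\<xi>0 \<mu>) \<xi>1 / refl_den (\<xi>0 \<mu>) \<xi>1 \<longrightarrow>
        (\<exists>\<eta>1 \<eta>2 V.
           point_characteristic S N p1 (\<xi>1, \<eta>1) (Phi ((\<xi>0 \<mu>, \<eta>0 \<mu>), r0 \<mu>)) (\<xi>2, \<eta>2) p2 V \<and>
           (dir \<xi>1 \<bullet> dir (\<xi>0 \<mu>) \<le> 0 \<longrightarrow>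
              V = characteristic_abs p1 p2 \<xi>1 \<xi>2 (r0 \<mu>) \<or>
              V = - characteristic_abs p1 p2 \<xi>1 \<xi>2 (r0 \<mu>))))"
proof (intro conjI allI impI ballI)
  fix p1 p2 \<xi>1 \<eta>1 p \<xi>2 \<eta>2 V
  assume V: "point_characteristic S N p1 (\<xi>1, \<eta>1) p (\<xi>2, \<eta>2) p2 V"
  then have ray: "reflected_ray S N p1 (\<xi>1, \<eta>1) p (\<xi>2, \<eta>2) p2"
    by (simp add: point_characteristic_def)
  then have "p \<in> patch S N" by (simp add: reflected_ray_def)
  then obtain \<mu> where \<mu>: "\<mu> \<in> M" "p = Phi ((\<xi>0 \<mu>, \<eta>0 \<mu>), r0 \<mu>)" "N p = dir (\<xi>0 \<mu>)"
      "\<xi>0 \<mu> \<in> (pi1 \<circ> Phi_S_inv N) ` patch S N"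
    using normal_congruence_parameter[OF surface param] by metis
  show "\<exists>\<mu>\<in>M. p = Phi ((\<xi>0 \<mu>, \<eta>0 \<mu>), r0 \<mu>) \<and> N p = dir (\<xi>0 \<mu>) \<and>
           \<xi>0 \<mu> \<in> (pi1 \<circ> Phi_S_inv N) ` patch S N \<and>
           eq_final_ray p1 p2 (\<xi>0 \<mu>) (r0 \<mu>) \<xi>1 \<and>
           eq_initial_ray p1 (\<xi>0 \<mu>) (\<eta>0 \<mu>) (r0 \<mu>) \<xi>1 \<and>
           refl_den (\<xi>0 \<mu>) \<xi>1 \<noteq> 0 \<and>
           \<xi>2 = refl_num (\<xi>0 \<mu>) \<xi>1 / refl_den (\<xi>0 \<mu>) \<xi>1 \<and>
           (dir \<xi>1 \<bullet> dir (\<xi>0 \<mu>) \<le> 0 \<longrightarrow>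
              V = characteristic_abs p1 p2 \<xi>1 \<xi>2 (r0 \<mu>) \<or>
              V = - characteristic_abs p1 p2 \<xi>1 \<xi>2 (r0 \<mu>))"
    using \<mu> ray[unfolded reflected_ray_iff[OF \<mu>(3,2) \<open>p \<in> patch S N\<close>]]
      point_characteristic_abs[OF V \<mu>(3,2)] by blast
next
  fix p1 p2 \<xi>1 \<xi>2 \<mu>
  assume "\<mu> \<in> M"
    and eqs: "\<xi>0 \<mu> \<in> (pi1 \<circ> Phi_S_inv N) ` patch S N \<and>
        eq_final_ray p1 p2 (\<xi>0 \<mu>) (r0 \<mu>) \<xi>1 \<and>
        eq_initial_ray p1 (\<xi>0 \<mu>) (\<eta>0 \<mu>) (r0 \<mu>) \<xi>1 \<and>
        refl_den (\<xi>0 \<mu>) \<xi>1 \<noteq> 0 \<and>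
        \<xi>2 = refl_num (\<xi>0 \<mu>) \<xi>1 / refl_den (\<xi>0 \<mu>) \<xi>1"
  define p where "p = Phi ((\<xi>0 \<mu>, \<eta>0 \<mu>), r0 \<mu>)"
  have p: "p \<in> patch S N" "N p = dir (\<xi>0 \<mu>)"
    using normal_congruence_point[OF surface param \<open>\<mu> \<in> M\<close>] by (simp_all add: p_def)
  have "reflected_ray S N p1 (\<xi>1, twice_eta \<xi>1 p / 2) p (\<xi>2, twice_eta \<xi>2 p / 2) p2"
    using eqs by (simp add: reflected_ray_iff[OF p(2) p_def p(1)])
  then obtain V where
    V: "point_characteristic S N p1 (\<xi>1, twice_eta \<xi>1 p / 2) p (\<xi>2, twice_eta \<xi>2 p / 2) p2 V"
    by (simp add: point_characteristic_def)
  show "\<exists>\<eta>1 \<eta>2 V.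
           point_characteristic S N p1 (\<xi>1, \<eta>1) (Phi ((\<xi>0 \<mu>, \<eta>0 \<mu>), r0 \<mu>)) (\<xi>2, \<eta>2) p2 V \<and>
           (dir \<xi>1 \<bullet> dir (\<xi>0 \<mu>) \<le> 0 \<longrightarrow>
              V = characteristic_abs p1 p2 \<xi>1 \<xi>2 (r0 \<mu>) \<or>
              V = - characteristic_abs p1 p2 \<xi>1 \<xi>2 (r0 \<mu>))"
    using V point_characteristic_abs[OF V p(2) p_def] unfolding p_def by blast
qed

end
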